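(* The set \[ F=\left\{\left.\begin{pmatrix} x & y & z\\ x' & y' & z'\end{pmatrix}\in \mathcal{M}^{+}_{\mathbb{Z}}\ \right|\ xyz\ \geq\ 2xx',\ 2yy',\ 2zz'\right\} \] is a fundamental domain for the action of $\Gamma$ on $\mathcal{M}^{\mathrm{CP}}_{\mathbb{Z}}$; that is, $F\subset \mathcal{M}^{\mathrm{CP}}_{\mathbb{Z}}$ and, for every $M\in\mathcal{M}^{\mathrm{CP}}_{\mathbb{Z}}$, the set $\Gamma(M)\cap F$ is a singleton. Moreover, the element of $\Gamma(M)\cap F$ is the smallest element of $\Gamma(M)$ with respect to the entrywise partial order $\leq$.
   Context: $\mathcal{M}$ is the set of real $2\times 3$ arrays $M=\begin{pmatrix} x & y & z\\ x' & y' & z'\end{pmatrix}$ with $xyz=x'y'z'$ and each column's two entries of the same sign; such $M$ encodes the skew-symmetrizable matrix $B=\begin{pmatrix}0&-z'&y\\ z&0&-x'\\ -y'&x&0\end{pmatrix}$. $\mathcal{M}^{+}$ is the subset with all entries positive, and $\mathcal{M}^{+}_{\mathbb{Z}}$ the subset of $\mathcal{M}^{+}$ with integer entries. The maps $\gamma_k$ are $\gamma_1(M)=\begin{pmatrix} y'z'-x & y & z\\ yz-x' & y' & z'\end{pmatrix}$, $\gamma_2(M)=\begin{pmatrix} x & z'x'-y & z\\ x' & zx-y' & z'\end{pmatrix}$, $\gamma_3(M)=\begin{pmatrix} x & y & x'y'-z\\ x' & y' & xy-z'\end{pmatrix}$ (these are $-\mu_k$ on cyclic matrices), and $\Gamma$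 is the group they generate; $\Gamma(M)$ is the set of all $\gamma_{t_k}\cdots\gamma_{t_1}(M)$ over finite index sequences with $t_i\neq t_{i+1}$. An element $M\in\mathcal{M}^{+}$ is cluster-positive if every element of $\Gamma(M)$ has all entries positive; $\mathcal{M}^{\mathrm{CP}}_{\mathbb{Z}}$ is the set of cluster-positive elements with integer entries. The order $\leq$ on $\mathcal{M}$ is the entrywise order. *)

theory Defs
  imports "HOL-Analysis.Analysis" "HOL-Algebra.Bij" "HOL-Algebra.Generated_Groups"
begin

definition arr :: "real \<Rightarrow> real \<Rightarrow> real \<Rightarrow> real \<Rightarrow> real \<Rightarrow> real \<Rightarrow> real^3^2" where
  "arr x y z x' y' z' = vector [vector [x, y, z], vector [x', y', z']]"

lemma arr_nth [simp]:
  "arr x y z x' y' z' $ 1 $ 1 = x" "arr x y z x' y' z' $ 1 $ 2 = y" "arr x y z x' y' z' $ 1 $ 3 = z"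
  "arr x y z x' y' z' $ 2 $ 1 = x'" "arr x y z x' y' z' $ 2 $ 2 = y'" "arr x y z x' y' z' $ 2 $ 3 = z'"
  by (simp_all add: arr_def)

lemma arr_eta: "arr (M$1$1) (M$1$2) (M$1$3) (M$2$1) (M$2$2) (M$2$3) = M"
  by (simp add: vec_eq_iff forall_2 forall_3)

text \<open>An array encodes the skew-symmetrizable matrix
  \<open>((0, -z', y), (z, 0, -x'), (-y', x, 0))\<close>. Its opposite entries vanish simultaneously, so
  ``the same sign'' is equality of \<^const>\<open>sgn\<close>, a zero being paired only with a zero.\<close>
definition cyc_arrays :: "(real^3^2) set" where
  "cyc_arrays = {arr x y z x' y' z' | x y z x' y' z'.
     x * y * z = x' * y' * z' \<and> sgn x = sgn x' \<and> sgn y = sgn y' \<and> sgn z = sgn z'}"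

definition all_pos :: "real^3^2 \<Rightarrow> bool" where
  "all_pos M \<longleftrightarrow> (\<forall>i j. M $ i $ j > 0)"

definition cyc_arrays_pos :: "(real^3^2) set" where
  "cyc_arrays_pos = {M \<in> cyc_arrays. all_pos M}"

definition cyc_arrays_pos_int :: "(real^3^2) set" where
  "cyc_arrays_pos_int = {M \<in> cyc_arrays_pos. \<forall>i j. M $ i $ j \<in> \<int>}"

text \<open>The index type \<open>3\<close> has exactly the elements \<open>1\<close>, \<open>2\<close>, \<open>3\<close>, with \<open>3 = 0\<close>.\<close>
definition \<gamma> :: "3 \<Rightarrow> real^3^2 \<Rightarrow> real^3^2" where
  "\<gamma> k M =
    (let x = M$1$1; y = M$1$2; z = M$1$3; x' = M$2$1; y' = M$2$2; z' = M$2$3 in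
     if k = 1 then arr (y' * z' - x) y z (y * z - x') y' z'
     else if k = 2 then arr x (z' * x' - y) z x' (z * x - y') z'
     else arr x y (x' * y' - z) x' y' (x * y - z'))"

text \<open>\<open>fold \<gamma> [t\<^sub>1, \<dots>, t\<^sub>k] M\<close> applies \<open>\<gamma> t\<^sub>1\<close> first. The empty sequence is allowed.\<close>
definition \<Gamma>_orbit :: "real^3^2 \<Rightarrow> (real^3^2) set" where
  "\<Gamma>_orbit M = {fold \<gamma> ts M | ts. successively (\<noteq>) ts}"

definition cluster_positive :: "real^3^2 \<Rightarrow> bool" where
  "cluster_positive M \<longleftrightarrow> M \<in> cyc_arrays_pos \<and> (\<forall>N \<in> \<Gamma>_orbit M. all_pos N)"

text \<open>The library order on \<open>real^3^2\<close> is entrywise.\<close>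
lemma arr_le_iff: "(M :: real^3^2) \<le> N \<longleftrightarrow> (\<forall>i j. M $ i $ j \<le> N $ i $ j)"
  by (simp add: less_eq_vec_def)

definition cluster_positive_int :: "(real^3^2) set" where
  "cluster_positive_int = {M. cluster_positive M \<and> (\<forall>i j. M $ i $ j \<in> \<int>)}"

definition fund_dom :: "(real^3^2) set" where
  "fund_dom = {arr x y z x' y' z' | x y z x' y' z'.
     arr x y z x' y' z' \<in> cyc_arrays_pos_int \<and>
     x * y * z \<ge> 2 * x * x' \<and> x * y * z \<ge> 2 * y * y' \<and> x * y * z \<ge> 2 * z * z'}"

definition \<Gamma>_group :: "(real^3^2 \<Rightarrow> real^3^2) set" where
  "\<Gamma>_group = generate (BijGroup cyc_arrays) (range (\<lambda>k. restrict (\<gamma> k) cyc_arrays))"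

text \<open>On cyclic arrays \<^const>\<open>\<Gamma>_orbit\<close>, defined through reduced words, is the orbit
  under the group \<^const>\<open>\<Gamma>_group\<close> generated by the three involutions.\<close>

lemma \<gamma>_invol [simp]: "\<gamma> k (\<gamma> k M) = M"
  by (subst (3) arr_eta [symmetric]) (auto simp: \<gamma>_def Let_def)

lemma cyc_arrays_iff: "M \<in> cyc_arrays \<longleftrightarrow>
    M$1$1 * M$1$2 * M$1$3 = M$2$1 * M$2$2 * M$2$3 \<and> (\<forall>j. sgn (M$1$j) = sgn (M$2$j))"
proof
  assume "M$1$1 * M$1$2 * M$1$3 = M$2$1 * M$2$2 * M$2$3 \<and> (\<forall>j. sgn (M$1$j) = sgn (M$2$j))"
  then show "M \<in> cyc_arrays"
    unfolding cyc_arrays_def using arr_eta [of M, symmetric] by blast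
qed (auto simp: cyc_arrays_def forall_3)

lemma same_sgn_aux:
  fixes a b a' b' c c' :: real
  assumes "a * b * c = a' * b' * c'" "sgn a = sgn a'" "sgn b = sgn b'" "sgn c = sgn c'"
  shows "(a' * b' - c) * (a * b) = (a * b - c') * (a' * b')"
    and "sgn (a' * b' - c) = sgn (a * b - c')"
proof -
  show eq: "(a' * b' - c) * (a * b) = (a * b - c') * (a' * b')"
    using assms(1) by (simp add: algebra_simps)
  have s: "sgn (a * b) = sgn (a' * b')"
    using assms by (simp add: sgn_mult)
  show "sgn (a' * b' - c) = sgn (a * b - c')"
  proof (cases "a * b = 0")
    case True
    then have "a' * b' = 0" using s by (metis sgn_zero_iff)
    then show ?thesis unfolding True using assms(4) by (metis diff_0 sgn_minus)
  next
    case False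
    have "sgn (a' * b' - c) * sgn (a * b) = sgn (a * b - c') * sgn (a * b)"
      using eq s by (metis sgn_mult)
    then show ?thesis using False by (simp add: sgn_zero_iff)
  qed
qed

lemma \<gamma>_cyc: assumes "M \<in> cyc_arrays" shows "\<gamma> k M \<in> cyc_arrays"
proof -
  have M: "M$1$1 * M$1$2 * M$1$3 = M$2$1 * M$2$2 * M$2$3"
    "sgn (M$1$1) = sgn (M$2$1)" "sgn (M$1$2) = sgn (M$2$2)" "sgn (M$1$3) = sgn (M$2$3)"
    using assms by (auto simp: cyc_arrays_iff)
  have "k = 1 \<or> k = 2 \<or> k = 3" using exhaust_3 by blast
  then show ?thesis
    using M same_sgn_aux [of "M$1$2" "M$1$3" "M$1$1" "M$2$2" "M$2$3" "M$2$1"]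
      same_sgn_aux [of "M$1$3" "M$1$1" "M$1$2" "M$2$3" "M$2$1" "M$2$2"]
      same_sgn_aux [of "M$1$1" "M$1$2" "M$1$3" "M$2$1" "M$2$2" "M$2$3"]
    by (elim disjE) (auto simp: cyc_arrays_iff \<gamma>_def Let_def forall_3 mult_ac)
qed

lemma \<Gamma>_orbit_refl: "M \<in> \<Gamma>_orbit M"
  unfolding \<Gamma>_orbit_def by (intro CollectI exI [of _ "[]"]) simp

lemma \<Gamma>_orbit_step: assumes "N \<in> \<Gamma>_orbit M" shows "\<gamma> k N \<in> \<Gamma>_orbit M"
proof -
  obtain ts where ts: "N = fold \<gamma> ts M" "successively (\<noteq>) ts"
    using assms by (auto simp: \<Gamma>_orbit_def)
  show ?thesis
  proof (cases "ts \<noteq> [] \<and> last ts = k")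
    case True
    then obtain us where us: "ts = us @ [k]" by (metis append_butlast_last_id)
    then have "\<gamma> k N = fold \<gamma> us M" "successively (\<noteq>) us"
      using ts by (auto simp: successively_append_iff)
    then show ?thesis by (auto simp: \<Gamma>_orbit_def)
  next
    case False
    then have "\<gamma> k N = fold \<gamma> (ts @ [k]) M" "successively (\<noteq>) (ts @ [k])"
      using ts by (auto simp: successively_append_iff)
    then show ?thesis unfolding \<Gamma>_orbit_def by blast
  qed
qed

lemma \<Gamma>_orbit_trans: assumes "N \<in> \<Gamma>_orbit M" "L \<in> \<Gamma>_orbit N" shows "L \<in> \<Gamma>_orbit M"
proof -
  have "fold \<gamma> ts N \<in> \<Gamma>_orbit M" for ts
    using assms(1) by (induction ts rule: rev_induct) (auto intro: \<Gamma>_orbit_step)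
  then show ?thesis using assms(2) by (auto simp: \<Gamma>_orbit_def)
qed

lemma \<Gamma>_orbit_cyc: assumes "M \<in> cyc_arrays" "N \<in> \<Gamma>_orbit M" shows "N \<in> cyc_arrays"
proof -
  have "fold \<gamma> ts M \<in> cyc_arrays" for ts
    using assms(1) by (induction ts rule: rev_induct) (auto intro: \<gamma>_cyc)
  then show ?thesis using assms(2) by (auto simp: \<Gamma>_orbit_def)
qed

lemma \<gamma>_Bij: "restrict (\<gamma> k) cyc_arrays \<in> Bij cyc_arrays"
proof -
  have "bij_betw (\<gamma> k) cyc_arrays cyc_arrays"
    by (rule bij_betwI [where g = "\<gamma> k"]) (auto intro: \<gamma>_cyc)
  then show ?thesis by (simp add: Bij_def cong: bij_betw_cong)
qed

lemma \<gamma>_inv: "inv\<^bsub>BijGroup cyc_arrays\<^esub> (restrict (\<gamma> k) cyc_arrays) = restrict (\<gamma> k) cyc_arrays"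
proof -
  interpret group "BijGroup cyc_arrays" by (rule group_BijGroup)
  have "restrict (\<gamma> k) cyc_arrays \<otimes>\<^bsub>BijGroup cyc_arrays\<^esub> restrict (\<gamma> k) cyc_arrays
        = \<one>\<^bsub>BijGroup cyc_arrays\<^esub>"
    using \<gamma>_Bij [of k] by (auto simp: BijGroup_def compose_def \<gamma>_cyc fun_eq_iff)
  then show ?thesis
    using \<gamma>_Bij [of k] by (intro inv_equality) (auto simp: BijGroup_def)
qed

lemma \<Gamma>_orbit_eq_group_orbit:
  assumes M: "M \<in> cyc_arrays"
  shows "\<Gamma>_orbit M = (\<lambda>g. g M) ` \<Gamma>_group"
proof
  interpret group "BijGroup cyc_arrays" by (rule group_BijGroup)
  have sub: "\<Gamma>_group \<subseteq> Bij cyc_arrays"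
    using generate_incl [of "range (\<lambda>k. restrict (\<gamma> k) cyc_arrays)"] \<gamma>_Bij
    by (auto simp: \<Gamma>_group_def BijGroup_def)
  have "fold \<gamma> ts M \<in> (\<lambda>g. g M) ` \<Gamma>_group \<and> fold \<gamma> ts M \<in> cyc_arrays" for ts
  proof (induction ts rule: rev_induct)
    case Nil
    have "\<one>\<^bsub>BijGroup cyc_arrays\<^esub> \<in> \<Gamma>_group"
      unfolding \<Gamma>_group_def by (rule generate.one)
    then have "(\<lambda>x\<in>cyc_arrays. x) \<in> \<Gamma>_group" by (simp add: BijGroup_def)
    from imageI [OF this, of "\<lambda>g. g M"] show ?case using M by simp
  next
    case (snoc k ts)
    then obtain g where g: "g \<in> \<Gamma>_group" "fold \<gamma> ts M = g M" by auto
    let ?h = "restrict (\<gamma> k) cyc_arrays \<otimes>\<^bsub>BijGroup cyc_arrays\<^esub> g"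
    have "?h \<in> \<Gamma>_group"
      using g unfolding \<Gamma>_group_def by (intro generate.eng) (auto intro: generate.incl)
    moreover have "?h M = \<gamma> k (g M)"
      using g sub \<gamma>_Bij [of k] M snoc by (auto simp: BijGroup_def compose_def subset_iff)
    ultimately show ?case
      using g snoc by (auto simp: \<gamma>_cyc intro!: rev_image_eqI [of ?h])
  qed
  then show "\<Gamma>_orbit M \<subseteq> (\<lambda>g. g M) ` \<Gamma>_group" by (auto simp: \<Gamma>_orbit_def)
  have "\<forall>N \<in> cyc_arrays. g N \<in> \<Gamma>_orbit N" if "g \<in> \<Gamma>_group" for g
    using that unfolding \<Gamma>_group_def
  proof (induction rule: generate.induct)
    case one
    show ?case by (auto simp: BijGroup_def \<Gamma>_orbit_refl)
  next
    case (incl h)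
    then show ?case by (auto intro: \<Gamma>_orbit_step [OF \<Gamma>_orbit_refl])
  next
    case (inv h)
    then show ?case by (auto simp: \<gamma>_inv intro: \<Gamma>_orbit_step [OF \<Gamma>_orbit_refl])
  next
    case (eng h1 h2)
    then have "h1 \<in> Bij cyc_arrays" "h2 \<in> Bij cyc_arrays"
      using sub by (auto simp: \<Gamma>_group_def)
    then have "(h1 \<otimes>\<^bsub>BijGroup cyc_arrays\<^esub> h2) N = h1 (h2 N)" if "N \<in> cyc_arrays" for N
      using that by (simp add: BijGroup_def compose_def)
    then show ?case
      using eng.IH by (metis \<Gamma>_orbit_trans \<Gamma>_orbit_cyc)
  qed
  then show "(\<lambda>g. g M) ` \<Gamma>_group \<subseteq> \<Gamma>_orbit M" using M by auto
qed

end

theory Submission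
  imports Defs
begin

text \<open>On positive arrays, \<open>M \<le> \<gamma>\<^sub>k(M)\<close> is the \<open>k\<close>-th inequality defining the domain, so \<open>F\<close>
  consists of the positive integer arrays that no \<open>\<gamma>\<^sub>k\<close> decreases. In an array of \<open>F\<close> every column
  has product at least 4. This makes a step that follows an increasing step in another
  direction increasing again, so entries never decrease along a reduced word starting in \<open>F\<close>.
  Hence an element of \<open>F\<close> is the smallest one of its orbit. Conversely, each integer
  cluster-positive orbit contains an array whose first row has minimal sum, and it lies in \<open>F\<close> because
  both entries of a column change by amounts of the same sign.\<close>

section \<open>Row arithmetic modulo 2 and the entries of \<open>\<gamma> k M\<close>\<close>

lemma three_eq_one_mod_2 [simp]: "(3 :: 2) = 1"
  by simp

lemma two_add_one_add_one [simp]: "r + 1 + 1 = (r :: 2)"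
  using exhaust_2 [of r] by auto

lemma all_pos_mono: "all_pos M \<Longrightarrow> M \<le> N \<Longrightarrow> all_pos N"
  by (meson all_pos_def arr_le_iff less_le_trans)

text \<open>In the index type \<open>2\<close>, \<open>r + 1\<close> is the row other than
  \<open>r\<close>. This formula therefore covers both rows and, with \<open>i\<close> and
  \<open>j\<close> in either order, all three directions.\<close>

lemma \<gamma>_nth_same:
  assumes "distinct [i, j, k]"
  shows "\<gamma> k M $ r $ k = M $ (r + 1) $ i * M $ (r + 1) $ j - M $ r $ k"
  using exhaust_3 [of k] exhaust_2 [of r] exhaust_3 [of i] exhaust_3 [of j] assms
  by (elim disjE) (simp_all add: \<gamma>_def Let_def)

lemma \<gamma>_nth_other [simp]: "l \<noteq> k \<Longrightarrow> \<gamma> k M $ r $ l = M $ r $ l"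
  using exhaust_3 [of l] exhaust_3 [of k] exhaust_2 [of r]
  by (elim disjE) (simp_all add: \<gamma>_def Let_def)

lemma ex_distinct_3: "\<exists>i j :: 3. distinct [i, j, k]"
proof -
  have "distinct [2, 3, 1 :: 3]" "distinct [3, 1, 2 :: 3]" "distinct [1, 2, 3 :: 3]" by simp_all
  then show ?thesis using exhaust_3 [of k] by blast
qed

lemma ex_distinct_third:
  fixes j k :: 3
  assumes "j \<noteq> k"
  shows "\<exists>i. distinct [i, j, k]"
proof -
  obtain a b where "distinct [a, b, k]" using ex_distinct_3 by blast
  then show ?thesis using assms by (cases "a = j") auto
qed

section \<open>Increasing and decreasing directions\<close>

lemma le_\<gamma>_iff:
  assumes "distinct [i, j, k]"
  shows "M \<le> \<gamma> k M \<longleftrightarrow> (\<forall>r. 2 * M $ r $ k \<le> M $ (r + 1) $ i * M $ (r + 1) $ j)"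
proof -
  have "M \<le> \<gamma> k M \<longleftrightarrow> (\<forall>r. M $ r $ k \<le> \<gamma> k M $ r $ k)"
    unfolding arr_le_iff by (metis \<gamma>_nth_other order_refl)
  also have "\<dots> \<longleftrightarrow> (\<forall>r. 2 * M $ r $ k \<le> M $ (r + 1) $ i * M $ (r + 1) $ j)"
    unfolding \<gamma>_nth_same [OF assms] by (simp add: algebra_simps)
  finally show ?thesis .
qed

lemma \<gamma>_le_iff:
  assumes "distinct [i, j, k]"
  shows "\<gamma> k M \<le> M \<longleftrightarrow> (\<forall>r. M $ (r + 1) $ i * M $ (r + 1) $ j \<le> 2 * M $ r $ k)"
proof -
  have "\<gamma> k M \<le> M \<longleftrightarrow> (\<forall>r. \<gamma> k M $ r $ k \<le> M $ r $ k)"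
    unfolding arr_le_iff by (metis \<gamma>_nth_other order_refl)
  also have "\<dots> \<longleftrightarrow> (\<forall>r. M $ (r + 1) $ i * M $ (r + 1) $ j \<le> 2 * M $ r $ k)"
    unfolding \<gamma>_nth_same [OF assms] by (simp add: algebra_simps)
  finally show ?thesis .
qed

text \<open>By \<open>le_\<gamma>_iff\<close>, direction \<open>k\<close> is increasing when column
  \<open>k\<close> is bounded by products of entries of the other two columns. Positivity makes
  these products grow from \<open>M\<close> to \<open>N\<close>, while column \<open>k\<close> stays
  fixed.\<close>

lemma le_\<gamma>_mono:
  assumes "all_pos M" "M \<le> N" "M \<le> \<gamma> k M" "\<And>r. M $ r $ k = N $ r $ k"
  shows "N \<le> \<gamma> k N"
proof -
  obtain i j where d: "distinct [i, j, k]" using ex_distinct_3 by blast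
  have "2 * N $ r $ k \<le> N $ (r + 1) $ i * N $ (r + 1) $ j" for r
  proof -
    have "2 * N $ r $ k \<le> M $ (r + 1) $ i * M $ (r + 1) $ j"
      using assms(3,4) le_\<gamma>_iff [OF d, of M] by simp
    also have "\<dots> \<le> N $ (r + 1) $ i * N $ (r + 1) $ j"
      using assms(1) all_pos_mono [OF assms(1,2)] assms(2)
      by (intro mult_mono) (auto simp: all_pos_def arr_le_iff less_imp_le)
    finally show ?thesis .
  qed
  then show ?thesis by (simp add: le_\<gamma>_iff [OF d])
qed

text \<open>Chain the inequality for direction \<open>k\<close> in row \<open>r\<close> with the one
  for direction \<open>j\<close> in the other row. Each contributes a factor 2, and the positive
  entry \<open>M $ r $ k\<close> cancels.\<close>

lemma column_product_ge_4:
  assumes "all_pos M" "\<And>k. M \<le> \<gamma> k M"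
  shows "4 \<le> M $ r $ l * M $ (r + 1) $ l"
proof -
  obtain k j where d: "distinct [k, j, l]" using ex_distinct_3 by blast
  then have d1: "distinct [l, j, k]" and d2: "distinct [k, l, j]" by auto
  have "2 * M $ r $ k \<le> M $ (r + 1) $ l * M $ (r + 1) $ j"
    using assms(2) [of k] unfolding le_\<gamma>_iff [OF d1] by blast
  moreover have "2 * M $ (r + 1) $ j \<le> M $ r $ k * M $ r $ l"
    using assms(2) [of j, unfolded le_\<gamma>_iff [OF d2], rule_format, of "r + 1"] by simp
  then have "M $ (r + 1) $ l * (2 * M $ (r + 1) $ j) \<le> M $ (r + 1) $ l * (M $ r $ k * M $ r $ l)"
    using assms(1) by (intro mult_left_mono) (auto simp: all_pos_def less_imp_le)
  ultimately have "4 * M $ r $ k \<le> (M $ r $ l * M $ (r + 1) $ l) * M $ r $ k"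
    by (simp add: algebra_simps)
  then show ?thesis using assms(1) by (simp add: all_pos_def)
qed

text \<open>Write \<open>p\<close> for the product of column \<open>i\<close> and \<open>c\<close>
  for \<open>M $ r $ k\<close>. After \<open>\<gamma> j\<close>, the product that must be at least
  \<open>2 * c\<close> equals \<open>p * c\<close> minus its old value. Here \<open>p * c\<close> is
  at least \<open>4 * c\<close>, and the old value is at most \<open>2 * c\<close> because direction
  \<open>k\<close> is decreasing.\<close>

lemma le_\<gamma>_after_other:
  assumes "distinct [i, j, k]" "all_pos M" "\<gamma> k M \<le> M"
    and i: "\<And>r. 4 \<le> M $ r $ i * M $ (r + 1) $ i"
  shows "\<gamma> j M \<le> \<gamma> k (\<gamma> j M)"
proof -
  have d: "distinct [k, i, j]" using assms(1) by auto
  have "2 * \<gamma> j M $ r $ k \<le> \<gamma> j M $ (r + 1) $ i * \<gamma> j M $ (r + 1) $ j" for r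
  proof -
    have "M $ (r + 1) $ i * M $ (r + 1) $ j \<le> 2 * M $ r $ k"
      using assms(3) \<gamma>_le_iff [OF assms(1), of M] by simp
    moreover have "4 * M $ r $ k \<le> M $ r $ i * M $ (r + 1) $ i * M $ r $ k"
      using assms(2) i by (intro mult_right_mono) (auto simp: all_pos_def less_imp_le)
    moreover have "\<gamma> j M $ r $ k = M $ r $ k"
      and ij: "\<gamma> j M $ (r + 1) $ i = M $ (r + 1) $ i"
        "\<gamma> j M $ (r + 1) $ j = M $ r $ k * M $ r $ i - M $ (r + 1) $ j"
      using assms(1) by (auto simp: \<gamma>_nth_same [OF d])
    moreover have "\<gamma> j M $ (r + 1) $ i * \<gamma> j M $ (r + 1) $ j
        = M $ r $ i * M $ (r + 1) $ i * M $ r $ k - M $ (r + 1) $ i * M $ (r + 1) $ j"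
      unfolding ij by (simp add: right_diff_distrib)
    ultimately show ?thesis by linarith
  qed
  then show ?thesis by (simp add: le_\<gamma>_iff [OF assms(1)])
qed

text \<open>The bound alone is not inductive. The other two conjuncts record that only the last
  letter, which undoes the last step, may fail to be increasing, and that it is decreasing.\<close>

lemma fold_\<gamma>_ge:
  assumes M: "all_pos M" "\<And>k. M \<le> \<gamma> k M" and "successively (\<noteq>) ts"
  shows "M \<le> fold \<gamma> ts M
    \<and> (\<forall>k. (ts = [] \<or> last ts \<noteq> k) \<longrightarrow> fold \<gamma> ts M \<le> \<gamma> k (fold \<gamma> ts M))
    \<and> (ts \<noteq> [] \<longrightarrow> \<gamma> (last ts) (fold \<gamma> ts M) \<le> fold \<gamma> ts M)"
  using assms(3)
proof (induction ts rule: rev_induct)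
  case Nil
  show ?case using M by simp
next
  case (snoc j ts)
  define N where "N = fold \<gamma> ts M"
  have s: "successively (\<noteq>) ts" "ts = [] \<or> last ts \<noteq> j"
    using snoc.prems by (auto simp: successively_append_iff)
  with snoc.IH have MN: "M \<le> N" and up: "\<And>k. ts = [] \<or> last ts \<noteq> k \<Longrightarrow> N \<le> \<gamma> k N"
    and down: "ts \<noteq> [] \<Longrightarrow> \<gamma> (last ts) N \<le> N"
    by (auto simp: N_def)
  have N: "all_pos N" using M(1) MN by (rule all_pos_mono)
  have j: "N \<le> \<gamma> j N" using up s by simp
  have "\<gamma> j N \<le> \<gamma> k (\<gamma> j N)" if kj: "k \<noteq> j" for k
  \<comment> \<open>If \<open>k\<close> is not the last letter of \<open>ts\<close>, it is
    increasing at \<open>N\<close> and the increasing step \<open>j\<close> preserves this.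
    Otherwise \<open>k\<close> is decreasing at \<open>N\<close>, and the bound 4 on column
    \<open>i\<close> is needed.\<close>
  proof (cases "ts = [] \<or> last ts \<noteq> k")
    case True
    show ?thesis by (rule le_\<gamma>_mono [OF N j up]) (use True kj in simp_all)
  next
    case False
    then have k: "\<gamma> k N \<le> N" using down by auto
    obtain i where d: "distinct [i, j, k]"
      using ex_distinct_third [of j k] kj by blast
    \<comment> \<open>The bound holds at \<open>M\<close> and passes to the larger array
      \<open>N\<close>.\<close>
    have "4 \<le> N $ r $ i * N $ (r + 1) $ i" for r
    proof -
      have "4 \<le> M $ r $ i * M $ (r + 1) $ i" using M by (rule column_product_ge_4)
      also have "\<dots> \<le> N $ r $ i * N $ (r + 1) $ i"
        using M(1) N MN by (intro mult_mono) (auto simp: all_pos_def arr_le_iff less_imp_le)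
      finally show ?thesis .
    qed
    then show ?thesis by (rule le_\<gamma>_after_other [OF d N k])
  qed
  with order_trans [OF MN j] j show ?case by (simp add: N_def)
qed

lemma \<Gamma>_orbit_ge:
  assumes "all_pos M" "\<And>k. M \<le> \<gamma> k M" "N \<in> \<Gamma>_orbit M"
  shows "M \<le> N"
  using assms(3) fold_\<gamma>_ge [OF assms(1,2)] by (auto simp: \<Gamma>_orbit_def)

text \<open>Each \<open>\<gamma> k\<close> is an involution, so the reversed word, which is again
  reduced, leads back.\<close>

lemma \<Gamma>_orbit_sym: assumes "N \<in> \<Gamma>_orbit M" shows "M \<in> \<Gamma>_orbit N"
proof -
  obtain ts where ts: "N = fold \<gamma> ts M" "successively (\<noteq>) ts"
    using assms by (auto simp: \<Gamma>_orbit_def)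
  have "fold \<gamma> (rev us) (fold \<gamma> us M) = M" for us
    by (induction us rule: rev_induct) simp_all
  moreover have "successively (\<noteq>) (rev ts)"
    using ts(2) by (simp add: successively_rev neq_commute)
  ultimately show ?thesis using ts(1) unfolding \<Gamma>_orbit_def
    by (metis (mono_tags, lifting) mem_Collect_eq)
qed

section \<open>The inequalities defining the domain\<close>

lemma cyc_arrays_row_le_iff:
  assumes M: "M \<in> cyc_arrays" "all_pos M" and d: "distinct [i, j, k]"
  shows "2 * M $ r $ k \<le> M $ (r + 1) $ i * M $ (r + 1) $ j
    \<longleftrightarrow> 2 * M $ 1 $ k * M $ 2 $ k \<le> M $ 1 $ 1 * M $ 1 $ 2 * M $ 1 $ 3"
proof -
  \<comment> \<open>Multiplying by this entry turns the right side into the full product of a row.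
    This product is the same for both rows, so the condition does not depend on
    \<open>r\<close>.\<close>
  have pos: "M $ (r + 1) $ k > 0" using M(2) by (simp add: all_pos_def)
  have "M $ (r + 1) $ k * (M $ (r + 1) $ i * M $ (r + 1) $ j) = M $ 1 $ 1 * M $ 1 $ 2 * M $ 1 $ 3"
    using M(1) d exhaust_3 [of i] exhaust_3 [of j] exhaust_3 [of k] exhaust_2 [of r]
    by (auto simp: cyc_arrays_iff mult_ac)
  moreover have "M $ (r + 1) $ k * (2 * M $ r $ k) = 2 * M $ 1 $ k * M $ 2 $ k"
    using exhaust_2 [of r] by auto
  ultimately show ?thesis using mult_le_cancel_left_pos [OF pos] by metis
qed

lemma le_\<gamma>_iff_product:
  assumes "M \<in> cyc_arrays" "all_pos M"
  shows "M \<le> \<gamma> k M \<longleftrightarrow> 2 * M $ 1 $ k * M $ 2 $ k \<le> M $ 1 $ 1 * M $ 1 $ 2 * M $ 1 $ 3"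
proof -
  obtain i j where d: "distinct [i, j, k]" using ex_distinct_3 by blast
  show ?thesis unfolding le_\<gamma>_iff [OF d] cyc_arrays_row_le_iff [OF assms d] by simp
qed

lemma le_\<gamma>_iff_row:
  assumes "M \<in> cyc_arrays" "all_pos M"
  shows "M \<le> \<gamma> k M \<longleftrightarrow> M $ r $ k \<le> \<gamma> k M $ r $ k"
proof -
  obtain i j where d: "distinct [i, j, k]" using ex_distinct_3 by blast
  have "M $ r $ k \<le> \<gamma> k M $ r $ k \<longleftrightarrow> 2 * M $ r $ k \<le> M $ (r + 1) $ i * M $ (r + 1) $ j"
    unfolding \<gamma>_nth_same [OF d] by linarith
  then show ?thesis
    using cyc_arrays_row_le_iff [OF assms d, of r] le_\<gamma>_iff_product [OF assms] by simp
qed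

lemma fund_dom_iff: "M \<in> fund_dom \<longleftrightarrow> M \<in> cyc_arrays_pos_int \<and> (\<forall>k. M \<le> \<gamma> k M)"
proof -
  have "M \<in> fund_dom \<longleftrightarrow> M \<in> cyc_arrays_pos_int \<and>
    (\<forall>k. 2 * M $ 1 $ k * M $ 2 $ k \<le> M $ 1 $ 1 * M $ 1 $ 2 * M $ 1 $ 3)"
  proof
    assume "M \<in> fund_dom"
    then show "M \<in> cyc_arrays_pos_int \<and>
      (\<forall>k. 2 * M $ 1 $ k * M $ 2 $ k \<le> M $ 1 $ 1 * M $ 1 $ 2 * M $ 1 $ 3)"
      by (auto simp: fund_dom_def forall_3)
  next
    assume "M \<in> cyc_arrays_pos_int \<and>
      (\<forall>k. 2 * M $ 1 $ k * M $ 2 $ k \<le> M $ 1 $ 1 * M $ 1 $ 2 * M $ 1 $ 3)"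
    then show "M \<in> fund_dom"
      unfolding fund_dom_def mem_Collect_eq
      by (intro exI conjI) (rule arr_eta [symmetric], simp_all add: arr_eta)
  qed
  also have "\<dots> \<longleftrightarrow> M \<in> cyc_arrays_pos_int \<and> (\<forall>k. M \<le> \<gamma> k M)"
    using le_\<gamma>_iff_product [of M] by (auto simp: cyc_arrays_pos_int_def cyc_arrays_pos_def)
  finally show ?thesis .
qed

section \<open>Existence and minimality of the representative\<close>

lemma \<Gamma>_orbit_Ints:
  assumes "\<forall>r k. M $ r $ k \<in> \<int>" "N \<in> \<Gamma>_orbit M"
  shows "N $ r $ k \<in> \<int>"
proof -
  have "\<forall>r k. fold \<gamma> ts M $ r $ k \<in> \<int>" for ts
  proof (induction ts rule: rev_induct)
    case Nil
    show ?case using assms(1) by simp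
  next
    case (snoc l ts)
    obtain i j where d: "distinct [i, j, l]" using ex_distinct_3 by blast
    have "\<gamma> l (fold \<gamma> ts M) $ r $ k \<in> \<int>" for r k
      using snoc by (cases "k = l") (simp_all add: \<gamma>_nth_same [OF d])
    then show ?case by simp
  qed
  then show ?thesis using assms(2) by (auto simp: \<Gamma>_orbit_def)
qed

lemma fund_dom_cluster_positive: "fund_dom \<subseteq> cluster_positive_int"
proof
  fix M assume "M \<in> fund_dom"
  then have M: "M \<in> cyc_arrays_pos_int" "\<And>k. M \<le> \<gamma> k M" by (auto simp: fund_dom_iff)
  then have "all_pos M" by (simp add: cyc_arrays_pos_int_def cyc_arrays_pos_def)
  then have "all_pos N" if "N \<in> \<Gamma>_orbit M" for N
    using \<Gamma>_orbit_ge M(2) that all_pos_mono by blast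
  then show "M \<in> cluster_positive_int"
    using M(1) by (simp add: cluster_positive_int_def cluster_positive_def cyc_arrays_pos_int_def)
qed

lemma fund_dom_minimal:
  assumes "N \<in> \<Gamma>_orbit M \<inter> fund_dom" "L \<in> \<Gamma>_orbit M"
  shows "N \<le> L"
proof -
  have "L \<in> \<Gamma>_orbit N" using assms \<Gamma>_orbit_sym \<Gamma>_orbit_trans by blast
  then show ?thesis
    using assms(1) \<Gamma>_orbit_ge by (auto simp: fund_dom_iff cyc_arrays_pos_int_def cyc_arrays_pos_def)
qed

lemma \<Gamma>_orbit_meets_fund_dom:
  assumes M: "M \<in> cluster_positive_int"
  shows "\<exists>N. N \<in> \<Gamma>_orbit M \<inter> fund_dom"
proof -
  have orb: "N \<in> cyc_arrays_pos_int" if "N \<in> \<Gamma>_orbit M" for N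
    using M that \<Gamma>_orbit_cyc \<Gamma>_orbit_Ints
    by (auto simp: cluster_positive_int_def cluster_positive_def cyc_arrays_pos_int_def cyc_arrays_pos_def)
  \<comment> \<open>By \<open>le_\<gamma>_iff_row\<close>, one row decides whether a direction is
    increasing, so the sum of the first row suffices as a measure.\<close>
  define S where "S N = (\<Sum>k\<in>UNIV. N $ 1 $ k)" for N :: "real^3^2"
  \<comment> \<open>On the orbit the measure takes natural values, so a minimum exists and
    truncation loses nothing.\<close>
  have S: "real (nat \<lfloor>S N\<rfloor>) = S N" if "N \<in> \<Gamma>_orbit M" for N
  proof -
    have "S N \<ge> 0"
      using orb [OF that] unfolding S_def
      by (intro sum_nonneg) (auto simp: cyc_arrays_pos_int_def cyc_arrays_pos_def all_pos_def less_imp_le)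
    moreover have "S N \<in> \<int>"
      using orb [OF that] unfolding S_def by (intro Ints_sum) (auto simp: cyc_arrays_pos_int_def)
    ultimately show ?thesis by (simp add: of_int_floor)
  qed
  obtain N where N: "N \<in> \<Gamma>_orbit M" and min: "\<And>L. L \<in> \<Gamma>_orbit M \<Longrightarrow> nat \<lfloor>S N\<rfloor> \<le> nat \<lfloor>S L\<rfloor>"
    using ex_has_least_nat [of "\<lambda>N. N \<in> \<Gamma>_orbit M" M "\<lambda>N. nat \<lfloor>S N\<rfloor>"] \<Gamma>_orbit_refl by blast
  have "N \<le> \<gamma> k N" for k
  proof -
    have L: "\<gamma> k N \<in> \<Gamma>_orbit M" using N by (rule \<Gamma>_orbit_step)
    have "S N \<le> S (\<gamma> k N)" using min [OF L] S [OF N] S [OF L] by linarith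
    moreover have "S L = L $ 1 $ k + (\<Sum>l\<in>UNIV - {k}. L $ 1 $ l)" for L
      unfolding S_def by (rule sum.remove) auto
    \<comment> \<open>Only column \<open>k\<close> moves, so comparing the sums compares the entries
      in that column.\<close>
    moreover have "(\<Sum>l\<in>UNIV - {k}. \<gamma> k N $ 1 $ l) = (\<Sum>l\<in>UNIV - {k}. N $ 1 $ l)"
      by (rule sum.cong) auto
    ultimately have "N $ 1 $ k \<le> \<gamma> k N $ 1 $ k" by simp
    then show ?thesis
      using orb [OF N] le_\<gamma>_iff_row by (auto simp: cyc_arrays_pos_int_def cyc_arrays_pos_def)
  qed
  then show ?thesis using N orb by (auto simp: fund_dom_iff)
qed

theorem theorem9p7:
  shows "fund_dom \<subseteq> cluster_positive_int
    \<and> (\<forall>M \<in> cluster_positive_int. is_singleton (\<Gamma>_orbit M \<inter> fund_dom))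
    \<and> (\<forall>M \<in> cluster_positive_int. \<forall>N \<in> \<Gamma>_orbit M \<inter> fund_dom. \<forall>L \<in> \<Gamma>_orbit M. N \<le> L)"
proof (intro conjI ballI)
  fix M assume "M \<in> cluster_positive_int"
  then obtain N where "N \<in> \<Gamma>_orbit M \<inter> fund_dom" using \<Gamma>_orbit_meets_fund_dom by blast
  \<comment> \<open>Each of the two elements is a lower bound of the orbit containing the
    other.\<close>
  moreover have "N = L" if "N \<in> \<Gamma>_orbit M \<inter> fund_dom" "L \<in> \<Gamma>_orbit M \<inter> fund_dom" for N L
    using that by (intro order_antisym fund_dom_minimal) auto
  ultimately show "is_singleton (\<Gamma>_orbit M \<inter> fund_dom)"
    by (intro is_singletonI') auto
qed (use fund_dom_cluster_positive fund_dom_minimal in auto)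

end
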